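(* Let $X=(X_1,X_2,\cdots,X_p)^\top$ be a $p$-tuple representing the $p$ items of a questionnaire. If $X$ is zero variation, then the Cronbach's alpha coefficient $$\alpha=\left(\frac{p}{p-1}\right)\left[1-\frac{\sum_{j=1}^p \mathbb{V}(X_j)}{\mathbb{V}\left(\sum_{\ell=1}^p X_\ell\right)}\right]$$ will be equal to $1$.
   Context: $\mathbb{V}(\cdot)$ denotes variance. The questionnaire has $p$ items, and the response to each item is a Likert-type score in $\{1,2,3,4,5\}$; $X_j$ denotes the response to item $j$. An observation vector $\mathbf{x}_i$ with $\mathbf{x}_i^\top=(x_{i1},x_{i2},\cdots,x_{ip})$ (the responses of respondent $i$ to the $p$ items) is called a zero variation vector if $x_{ij}=\text{constant}$, $j=1,\cdots,p$, i.e. the respondent gives the same answer to every item. For the $p$-tuple $X$, zero variation means that $X_j=W$ for $j=1,\cdots,p$, with one and the same random variable $W$ (which may differ from respondent to respondent). *)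

theory Defs
  imports "HOL-Probability.Probability"
begin

context prob_space
begin

definition likert_item :: "('a \<Rightarrow> real) \<Rightarrow> bool" where
  "likert_item Y \<longleftrightarrow>
     random_variable borel Y \<and> (\<forall>\<omega>\<in>space M. Y \<omega> \<in> {1, 2, 3, 4, 5})"

(* The items are X 1, ..., X p; a point of the probability space plays the role of a
   respondent, so W may take different values at different respondents. *)
definition zero_variation :: "nat \<Rightarrow> (nat \<Rightarrow> 'a \<Rightarrow> real) \<Rightarrow> bool" where
  "zero_variation p X \<longleftrightarrow>
     (\<exists>W. random_variable borel W \<and> (\<forall>j\<in>{1..p}. \<forall>\<omega>\<in>space M. X j \<omega> = W \<omega>))"

(* Meaningful only when p is at least 2 and the total score has nonzero variance:
   division by zero yields 0 here. *)
definition cronbach_alpha :: "nat \<Rightarrow> (nat \<Rightarrow> 'a \<Rightarrow> real) \<Rightarrow> real" where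
  "cronbach_alpha p X =
     (real p / (real p - 1)) *
     (1 - (\<Sum>j=1..p. variance (X j)) / variance (\<lambda>\<omega>. \<Sum>l=1..p. X l \<omega>))"

end

end

theory Submission imports Defs begin

text \<open>
  If every item equals the same random variable \<open>W\<close>, the total score is \<open>p W\<close>, whose
  variance is \<open>p\<^sup>2 Var W\<close>, whereas the item variances only add up to \<open>p Var W\<close>.
  The variance ratio in Cronbach's alpha is therefore \<open>1/p\<close>, and
  \<open>p/(p - 1) (1 - 1/p) = 1\<close>. The ratio may be cancelled because the variance of the total
  score is nonzero, which forces \<open>Var W \<noteq> 0\<close>.
\<close>

context prob_space
begin

text \<open>The expectation, and hence the deviation from it, only sees values on the sample space;
  agreement outside it, where random variables are arbitrary, is irrelevant.\<close>
lemma variance_cong: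
  fixes Y Z :: "'a \<Rightarrow> real"
  assumes "\<And>\<omega>. \<omega> \<in> space M \<Longrightarrow> Y \<omega> = Z \<omega>"
  shows "variance Y = variance Z"
proof -
  have "expectation Y = expectation Z"
    using assms by (rule Bochner_Integration.integral_cong[OF refl])
  then show ?thesis
    using assms by (intro Bochner_Integration.integral_cong) auto
qed

text \<open>The Bochner integral commutes with real scaling for every function: where it takes its
  default value \<open>0\<close>, scaling by \<open>c \<noteq> 0\<close> preserves non-integrability.\<close>
lemma variance_scale:
  fixes Y :: "'a \<Rightarrow> real"
  shows "variance (\<lambda>\<omega>. c * Y \<omega>) = c\<^sup>2 * variance Y"
proof -
  have "variance (\<lambda>\<omega>. c * Y \<omega>) = expectation (\<lambda>\<omega>. c\<^sup>2 * (Y \<omega> - expectation Y)\<^sup>2)"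
    by (simp add: power_mult_distrib flip: right_diff_distrib)
  then show ?thesis
    by simp
qed

lemma cronbach_alpha_zero_variation:
  assumes "p \<ge> 2"
    and nondegenerate: "variance (\<lambda>\<omega>. \<Sum>l=1..p. X l \<omega>) \<noteq> 0"
    and "zero_variation p X"
  shows "cronbach_alpha p X = 1"
proof -
  obtain W where W: "\<And>j \<omega>. j \<in> {1..p} \<Longrightarrow> \<omega> \<in> space M \<Longrightarrow> X j \<omega> = W \<omega>"
    using assms(3) unfolding zero_variation_def by blast
  have items: "(\<Sum>j=1..p. variance (X j)) = real p * variance W"
  proof -
    have "(\<Sum>j=1..p. variance (X j)) = (\<Sum>j=1..p. variance W)"
      by (intro sum.cong refl variance_cong W)
    then show ?thesis
      by simp
  qed
  have total: "variance (\<lambda>\<omega>. \<Sum>l=1..p. X l \<omega>) = (real p)\<^sup>2 * variance W"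
  proof -
    have "variance (\<lambda>\<omega>. \<Sum>l=1..p. X l \<omega>) = variance (\<lambda>\<omega>. real p * W \<omega>)"
      by (rule variance_cong) (simp add: W)
    then show ?thesis
      by (simp only: variance_scale)
  qed
  have "variance W \<noteq> 0"
    using nondegenerate unfolding total by simp
  then have "(real p * variance W) / ((real p)\<^sup>2 * variance W) = 1 / real p"
    using \<open>p \<ge> 2\<close> by (simp add: power2_eq_square)
  then have "cronbach_alpha p X = real p / (real p - 1) * (1 - 1 / real p)"
    unfolding cronbach_alpha_def items total by simp
  also have "\<dots> = 1"
    using \<open>p \<ge> 2\<close> by (simp add: field_simps)
  finally show ?thesis .
qed

end

theorem theorem1:
  fixes M :: "'a measure" and p :: nat and X :: "nat \<Rightarrow> 'a \<Rightarrow> real"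
  assumes "prob_space M"
    and "p \<ge> 2"
    and "\<And>j. j \<in> {1..p} \<Longrightarrow> prob_space.likert_item M (X j)"
    and "prob_space.variance M (\<lambda>\<omega>. \<Sum>l=1..p. X l \<omega>) \<noteq> 0"
    and "prob_space.zero_variation M p X"
  shows "prob_space.cronbach_alpha M p X = 1"
  using assms(1,2,4,5) by (rule prob_space.cronbach_alpha_zero_variation)

end
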